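(* Assume the smoothness assumption stated in the context, and let $(\rho_t)_{t\ge0}$ be a weak solution of $\partial_t\rho_t=2\zeta(t)\nabla_\omega\cdot\big(\rho_t\nabla_\omega\Phi(\omega;\rho_t)\big)$ such that $\operatorname{supp}\rho_t\subset K$ for every $t\ge0$. Then the trajectory $\{\rho_t:t\ge0\}$ is precompact in $W_1$.
   Context: Model. Fix positive integers $L,d_x,d_k,d_v$ and a fixed matrix $W_{\mathrm{out}}\in\mathbb R^{d_x\times d_v}$. A head parameter is $\omega=(W_Q,W_K,W_V,W_O)\in\mathbb R^{d_x\times d_k}\times\mathbb R^{d_x\times d_k}\times\mathbb R^{d_x\times d_k}\times\mathbb R^{d_k\times d_x}$, identified with a vector in $\mathbb R^{d_\omega}$. For an input $X\in\mathbb R^{L\times d_x}$ (rows are tokens), the causally masked attention matrix $A_\omega(X)\in\mathbb R^{L\times L}$ has entries $$A_\omega(X)_{rs}=\frac{\exp\big((XW_QW_K^\top X^\top)_{rs}/\sqrt{d_k}\big)}{\sum_{s'\le r}\exp\big((XW_QW_K^\top X^\top)_{rs'}/\sqrt{d_k}\big)}\ (s\le r),\qquad A_\omega(X)_{rs}=0\ (s>r).$$ $\psi_l(X;\omega)\in\mathbb R^{d_v}$ is the $l$-th row of $A_\omega(X)XW_VW_OW_{\mathrm{out}}$, $l=1,\dots,L$. Data and first variation. $X$ is a random input and $Y_l(X)\in\mathbb R^{d_v}$ is a one-hot label for each $l$; $\mathbb E_X$ is expectation over $X$. $\mathrm{softmax}_j(z)=e^{z_j}/\sum_m e^{z_m}$.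 For a probability measure $\rho$ on $\mathbb R^{d_\omega}$, $z_l^\rho(X)=\int\psi_l(X;\omega)\,\rho(d\omega)$, and $$\Phi(\omega;\rho)=\mathbb E_X\Big[\frac1L\sum_{l=1}^L\big\langle\mathrm{softmax}(z_l^\rho(X))-Y_l(X),\psi_l(X;\omega)\big\rangle\Big].$$ Weak solution. A narrowly continuous curve $t\mapsto\rho_t\in\mathcal P(K)$ such that for every $f\in C^1(K)$, $\frac{d}{dt}\int f\,d\rho_t=-2\zeta(t)\int\langle\nabla f(\omega),\nabla_\omega\Phi(\omega;\rho_t)\rangle\,\rho_t(d\omega)$ in the sense of distributions in time. Here $\zeta:[0,\infty)\to[0,\infty)$ is bounded and Lipschitz with $\int_0^\infty\zeta(t)\,dt=\infty$. $W_1$ is the 1-Wasserstein distance; precompact means having compact closure (every sequence has a $W_1$-convergent subsequence with limit in $\mathcal P(K)$). Smoothness assumption. $K\subset\mathbb R^{d_\omega}$ and $K_x\subset\mathbb R^{d_x}$ are compact, all measures considered are supported in $K$, all input tokens lie in $K_x$ (so $X\in K_x^L$), the maps $\omega\mapsto\psi_l(X;\omega)$ are $C^3$ on $K$ for all $l$ and almost every $X$, and there is $B_\psi<\infty$ with $$\sup_{X\in K_x^L,\,1\le l\le L,\,\omega\in K}\big(\|\psi_l(X;\omega)\|+\|\nabla_\omega\psi_l(X;\omega)\|+\|\nabla^2_\omega\psi_l(X;\omega)\|+\|\nabla^3_\omega\psi_l(X;\omega)\|\big)\le B_\psi.$$ *)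

theory Defs
  imports "HOL-Probability.Probability"
begin

section \<open>The masked attention head\<close>

text \<open>
  Dimensions are index types. The token positions \<open>1, \<dots>, L\<close> are a finite linearly ordered
  type \<open>'l\<close>, whose order is the one used by the causal mask. Matrices with \<open>m\<close> rows and \<open>n\<close>
  columns have type \<open>real^'n^'m\<close>. The norm, inner product and distance of the product type
  \<open>head\<close> are the Euclidean ones of the vector of all matrix entries.
\<close>

type_synonym ('l, 'dx) input = "real^'dx^'l"

type_synonym ('dx, 'dk) head =
  "(real^'dk^'dx) \<times> (real^'dk^'dx) \<times> (real^'dk^'dx) \<times> (real^'dx^'dk)"

definition attention_score ::
  "('dx::finite, 'dk::finite) head \<Rightarrow> ('l::{finite,linorder}, 'dx) input \<Rightarrow> real^('l::{finite,linorder})^('l::{finite,linorder})" where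
  "attention_score \<omega> X = (case \<omega> of (WQ, WK, WV, WO) \<Rightarrow>
     X ** WQ ** transpose WK ** transpose X)"

definition attention ::
  "('dx::finite, 'dk::finite) head \<Rightarrow> ('l::{finite,linorder}, 'dx) input \<Rightarrow> real^('l::{finite,linorder})^('l::{finite,linorder})" where
  "attention \<omega> X = (\<chi> r s.
     if s \<le> r
     then exp (attention_score \<omega> X $ r $ s / sqrt (real CARD('dk)))
        / (\<Sum>s'\<in>{..r}. exp (attention_score \<omega> X $ r $ s' / sqrt (real CARD('dk))))
     else 0)"

definition psi ::
  "real^'dv^'dx \<Rightarrow> 'l \<Rightarrow> ('l::{finite,linorder}, 'dx::finite) input
    \<Rightarrow> ('dx, 'dk::finite) head \<Rightarrow> real^'dv::finite" where
  "psi Wout l X \<omega> = (case \<omega> of (WQ, WK, WV, WO) \<Rightarrow>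
     row l (attention \<omega> X ** X ** WV ** WO ** Wout))"

definition softmax :: "real^'n \<Rightarrow> real^'n::finite" where
  "softmax z = (\<chi> j. exp (z $ j) / (\<Sum>m\<in>UNIV. exp (z $ m)))"

definition logits ::
  "real^'dv^'dx \<Rightarrow> ('dx::finite, 'dk::finite) head measure \<Rightarrow> 'l
    \<Rightarrow> ('l::{finite,linorder}, 'dx) input \<Rightarrow> real^'dv::finite" where
  "logits Wout \<rho> l X = (\<integral>\<omega>. psi Wout l X \<omega> \<partial>\<rho>)"

text \<open>\<open>P\<close> is the law of the random input \<open>X\<close> and \<open>Y l X\<close> is the label at position \<open>l\<close>.\<close>

definition first_variation ::
  "real^'dv^'dx \<Rightarrow> ('l::{finite,linorder}, 'dx::finite) input measure
    \<Rightarrow> ('l \<Rightarrow> ('l, 'dx) input \<Rightarrow> real^'dv::finite)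
    \<Rightarrow> ('dx, 'dk::finite) head measure \<Rightarrow> ('dx, 'dk) head \<Rightarrow> real" where
  "first_variation Wout P Y \<rho> \<omega> =
     (\<integral>X. (1 / real CARD('l)) *
        (\<Sum>l\<in>UNIV. (softmax (logits Wout \<rho> l X) - Y l X) \<bullet> psi Wout l X \<omega>) \<partial>P)"

definition one_hot :: "real^'n::finite \<Rightarrow> bool" where
  "one_hot y \<longleftrightarrow> (\<exists>j. y = axis j 1)"

section \<open>Differentiability\<close>

definition fderiv ::
  "('a::real_normed_vector \<Rightarrow> 'b::real_normed_vector) \<Rightarrow> 'a \<Rightarrow> 'a \<Rightarrow>\<^sub>L 'b" where
  "fderiv f x = (THE D. (f has_derivative blinfun_apply D) (at x))"

definition gradient :: "('a::real_inner \<Rightarrow> real) \<Rightarrow> 'a \<Rightarrow> 'a" where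
  "gradient f x = (THE D. GDERIV f x :> D)"

definition cont_diff ::
  "'a set \<Rightarrow> ('a::real_normed_vector \<Rightarrow> 'b::real_normed_vector) \<Rightarrow> bool" where
  "cont_diff U f \<longleftrightarrow> (\<forall>x\<in>U. f differentiable (at x)) \<and> continuous_on U (fderiv f)"

text \<open>
  On a compact set \<open>K\<close>, which may have empty interior, a function is \<open>C\<^sup>1\<close> or \<open>C\<^sup>3\<close> if it is so
  on some open neighbourhood of \<open>K\<close>. Iterates of \<open>fderiv\<close> take values in nested spaces of
  bounded linear maps, with the operator norm.
\<close>

definition C1_on :: "'a set \<Rightarrow> ('a::real_normed_vector \<Rightarrow> 'b::real_normed_vector) \<Rightarrow> bool" where
  "C1_on K f \<longleftrightarrow> (\<exists>U. open U \<and> K \<subseteq> U \<and> cont_diff U f)"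

definition C3_on :: "'a set \<Rightarrow> ('a::real_normed_vector \<Rightarrow> 'b::real_normed_vector) \<Rightarrow> bool" where
  "C3_on K f \<longleftrightarrow> (\<exists>U. open U \<and> K \<subseteq> U \<and>
     cont_diff U f \<and> cont_diff U (fderiv f) \<and> cont_diff U (fderiv (fderiv f)))"

section \<open>Probability measures and the 1-Wasserstein distance\<close>

text \<open>\<open>\<P>(K)\<close>, realised as Borel measures on the ambient space.\<close>

definition prob_measures_on :: "'a::topological_space set \<Rightarrow> 'a measure set" where
  "prob_measures_on K = {\<rho>. sets \<rho> = sets borel \<and> prob_space \<rho> \<and> emeasure \<rho> K = 1}"

definition measure_supp :: "'a::topological_space measure \<Rightarrow> 'a set" where
  "measure_supp \<rho> = {x. \<forall>U. open U \<longrightarrow> x \<in> U \<longrightarrow> emeasure \<rho> U > 0}"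

definition couplings ::
  "'a::topological_space measure \<Rightarrow> 'a measure \<Rightarrow> ('a \<times> 'a) measure set" where
  "couplings \<mu> \<nu> =
     {\<pi>. sets \<pi> = sets borel \<and> distr \<pi> borel fst = \<mu> \<and> distr \<pi> borel snd = \<nu>}"

definition W1 :: "'a::metric_space measure \<Rightarrow> 'a measure \<Rightarrow> ennreal" where
  "W1 \<mu> \<nu> = (INF \<pi>\<in>couplings \<mu> \<nu>. \<integral>\<^sup>+z. ennreal (dist (fst z) (snd z)) \<partial>\<pi>)"

definition W1_precompact :: "'a::metric_space set \<Rightarrow> 'a measure set \<Rightarrow> bool" where
  "W1_precompact K S \<longleftrightarrow>
     (\<forall>\<mu>. (\<forall>n. \<mu> n \<in> S) \<longrightarrow>
        (\<exists>r \<nu>. strict_mono (r :: nat \<Rightarrow> nat) \<and> \<nu> \<in> prob_measures_on K \<and>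
           (\<lambda>n. W1 (\<mu> (r n)) \<nu>) \<longlonglongrightarrow> 0))"

section \<open>Weak solutions\<close>

definition narrowly_continuous :: "(real \<Rightarrow> 'a::topological_space measure) \<Rightarrow> bool" where
  "narrowly_continuous \<rho> \<longleftrightarrow>
     (\<forall>g :: 'a \<Rightarrow> real. continuous_on UNIV g \<longrightarrow> bounded (range g) \<longrightarrow>
        continuous_on {0..} (\<lambda>t. \<integral>\<omega>. g \<omega> \<partial>\<rho> t))"

text \<open>\<open>C\<^sub>c\<^sup>\<infinity>((0,\<infinity>))\<close>\<close>

definition test_function :: "(real \<Rightarrow> real) \<Rightarrow> bool" where
  "test_function \<eta> \<longleftrightarrow>
     (\<forall>n. (deriv ^^ n) \<eta> differentiable_on UNIV) \<and>
     compact (closure {t. \<eta> t \<noteq> 0}) \<and> closure {t. \<eta> t \<noteq> 0} \<subseteq> {0<..}"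

definition has_distributional_deriv :: "(real \<Rightarrow> real) \<Rightarrow> (real \<Rightarrow> real) \<Rightarrow> bool" where
  "has_distributional_deriv u v \<longleftrightarrow>
     (\<forall>\<eta>. test_function \<eta> \<longrightarrow>
        - (LINT t:{0<..}|lborel. u t * deriv \<eta> t) = (LINT t:{0<..}|lborel. v t * \<eta> t))"

text \<open>
  The integrals over \<open>\<omega>\<close> are restricted to \<open>K\<close>: it carries \<open>\<rho> t\<close>, and the test function and
  its gradient are only meaningful near \<open>K\<close>.
\<close>

definition weak_solution ::
  "real^'dv^'dx \<Rightarrow> ('l::{finite,linorder}, 'dx::finite) input measure
    \<Rightarrow> ('l \<Rightarrow> ('l, 'dx) input \<Rightarrow> real^'dv::finite) \<Rightarrow> (real \<Rightarrow> real)
    \<Rightarrow> ('dx, 'dk::finite) head set \<Rightarrow> (real \<Rightarrow> ('dx, 'dk) head measure) \<Rightarrow> bool" where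
  "weak_solution Wout P Y \<zeta> K \<rho> \<longleftrightarrow>
     (\<forall>t\<ge>0. \<rho> t \<in> prob_measures_on K) \<and>
     narrowly_continuous \<rho> \<and>
     (\<forall>f :: ('dx, 'dk) head \<Rightarrow> real. C1_on K f \<longrightarrow>
        has_distributional_deriv
          (\<lambda>t. LINT \<omega>:K|\<rho> t. f \<omega>)
          (\<lambda>t. - 2 * \<zeta> t *
             (LINT \<omega>:K|\<rho> t. gradient f \<omega> \<bullet> gradient (first_variation Wout P Y (\<rho> t)) \<omega>)))"

section \<open>Standing assumptions\<close>

definition inputs_in :: "(real^'dx) set \<Rightarrow> ('l::finite, 'dx::finite) input set" where
  "inputs_in Kx = {X. \<forall>l. row l X \<in> Kx}"

definition smoothness_assumption ::
  "real^'dv^'dx \<Rightarrow> ('l::{finite,linorder}, 'dx::finite) input measure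
    \<Rightarrow> ('dx, 'dk::finite) head set \<Rightarrow> (real^'dx) set \<Rightarrow> bool" where
  "smoothness_assumption (Wout :: real^'dv::finite^'dx) P K Kx \<longleftrightarrow>
     compact K \<and> compact Kx \<and>
     (AE X in P. X \<in> inputs_in Kx) \<and>
     (AE X in P. \<forall>l. C3_on K (psi Wout l X)) \<and>
     (\<exists>B::real. \<forall>X\<in>(inputs_in Kx :: ('l, 'dx) input set). \<forall>l. \<forall>\<omega>\<in>K.
        norm (psi Wout l X \<omega>)
        + norm (fderiv (psi Wout l X) \<omega>)
        + norm (fderiv (fderiv (psi Wout l X)) \<omega>)
        + norm (fderiv (fderiv (fderiv (psi Wout l X))) \<omega>) \<le> B)"

definition admissible_rate :: "(real \<Rightarrow> real) \<Rightarrow> bool" where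
  "admissible_rate \<zeta> \<longleftrightarrow>
     (\<forall>t\<ge>0. 0 \<le> \<zeta> t) \<and> bounded (\<zeta> ` {0..}) \<and> (\<exists>C. C-lipschitz_on {0..} \<zeta>) \<and>
     (\<integral>\<^sup>+t\<in>{0..}. ennreal (\<zeta> t) \<partial>lborel) = \<infinity>"

end

(* A compact set K is coded by real numbers: the series of indicators of a countable basis in base 3
   gives a Borel map s into [0, 3/2] whose inverse on s(K) is uniformly continuous, so it extends to
   a continuous map G from the closure of s(K) onto K. Helly's theorem yields a weakly convergent
   subsequence of the images of the measures under s, Skorohod's theorem realises it by an everywhere
   convergent sequence of random variables, and composing with G gives couplings whose transport
   costs vanish by dominated convergence. Hence every set of probability measures on K is
   precompact in W1. *)

theory Submission
  imports Defs
begin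

section \<open>Series with digits 0 and 1 in base 3\<close>

lemma summable_ternary: "summable (\<lambda>n. of_bool (a n) * (1/3) ^ n :: real)"
  by (rule summable_comparison_test'[OF summable_geometric[of "1/3::real"], of 0]) auto

lemma ternary_bounds:
  "0 \<le> (\<Sum>n. of_bool (a n) * (1/3) ^ n :: real)" "(\<Sum>n. of_bool (a n) * (1/3) ^ n :: real) \<le> 3/2"
proof -
  show "0 \<le> (\<Sum>n. of_bool (a n) * (1/3) ^ n :: real)"
    by (intro suminf_nonneg summable_ternary) auto
  have "(\<Sum>n. of_bool (a n) * (1/3) ^ n :: real) \<le> (\<Sum>n. (1/3) ^ n)"
    by (intro suminf_le summable_ternary summable_geometric) auto
  then show "(\<Sum>n. of_bool (a n) * (1/3) ^ n :: real) \<le> 3/2"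
    by (simp add: suminf_geometric)
qed

text \<open>At the first index \<open>m\<close> where the digits differ, the leading terms are 3^-m
  apart, while the tails can offset at most (1/3) * (3/2) = 1/2 of that. Half of 3^-m survives, and
  \<open>m \<le> N\<close>. In base 2 the tail could cancel the leading digit entirely.\<close>

lemma ternary_gap:
  assumes "a N \<noteq> b N"
  shows "1 / (2 * 3 ^ N)
    \<le> \<bar>(\<Sum>n. of_bool (a n) * (1/3) ^ n) - (\<Sum>n. of_bool (b n) * (1/3) ^ n :: real)\<bar>"
proof -
  define m where "m = (LEAST n. a n \<noteq> b n)"
  have m: "a m \<noteq> b m" and "m \<le> N"
    using LeastI[of "\<lambda>n. a n \<noteq> b n", OF assms] Least_le[of "\<lambda>n. a n \<noteq> b n", OF assms]
    unfolding m_def by iprover+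
  have agree: "a n = b n" if "n < m" for n
    using not_less_Least[of n] that unfolding m_def by blast
  \<comment> \<open>Everything from index \<open>m\<close> on is scaled by 3^-m; the remainder
    beyond \<open>m\<close> is again a series of the same kind, so the bounds 0 and 3/2 apply to
    it.\<close>
  have tail: "(\<Sum>n. of_bool (c n) * (1/3) ^ n :: real)
      = (\<Sum>n<m. of_bool (c n) * (1/3) ^ n)
        + (1/3) ^ m * (of_bool (c m) + (1/3) * (\<Sum>n. of_bool (c (n + Suc m)) * (1/3) ^ n))" for c
  proof -
    have "(\<Sum>n. of_bool (c (n + Suc m)) * (1/3) ^ (n + Suc m) :: real)
        = (\<Sum>n. (1/3) ^ Suc m * (of_bool (c (n + Suc m)) * (1/3) ^ n))"
      by (simp add: power_add mult_ac)
    also have "\<dots> = (1/3) ^ Suc m * (\<Sum>n. of_bool (c (n + Suc m)) * (1/3) ^ n)"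
      by (rule suminf_mult) (rule summable_ternary)
    finally show ?thesis
      using suminf_split_initial_segment[OF summable_ternary[of c], of "Suc m"]
      by (simp add: algebra_simps)
  qed
  define u where "u c = (\<Sum>n. of_bool (c (n + Suc m)) * (1/3) ^ n :: real)" for c :: "nat \<Rightarrow> bool"
  have u: "0 \<le> u c" "u c \<le> 3/2" for c
    unfolding u_def using ternary_bounds[of "\<lambda>n. c (n + Suc m)"] by auto
  have "(\<Sum>n<m. of_bool (a n) * (1/3) ^ n :: real) = (\<Sum>n<m. of_bool (b n) * (1/3) ^ n)"
    by (intro sum.cong) (auto simp: agree)
  then have "(\<Sum>n. of_bool (a n) * (1/3) ^ n) - (\<Sum>n. of_bool (b n) * (1/3) ^ n :: real)
      = (1/3) ^ m * (of_bool (a m) - of_bool (b m) + (1/3) * (u a - u b))"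
    unfolding tail[of a] tail[of b] u_def by (simp add: algebra_simps)
  moreover have "1/2 \<le> \<bar>of_bool (a m) - of_bool (b m) + (1/3) * (u a - u b)\<bar>"
  proof -
    have "\<bar>u a - u b\<bar> \<le> 3/2"
      using u[of a] u[of b] by linarith
    then have "\<bar>(1/3) * (u a - u b)\<bar> \<le> 1/2"
      by (simp add: abs_mult)
    moreover have "\<bar>of_bool (a m) - of_bool (b m) :: real\<bar> = 1"
      using m by auto
    ultimately show ?thesis
      by linarith
  qed
  then have "(1/3) ^ m * (1/2) \<le> (1/3) ^ m * \<bar>of_bool (a m) - of_bool (b m) + (1/3) * (u a - u b)\<bar>"
    by (intro mult_left_mono) auto
  ultimately have "(1/3) ^ m * (1/2)
      \<le> \<bar>(\<Sum>n. of_bool (a n) * (1/3) ^ n) - (\<Sum>n. of_bool (b n) * (1/3) ^ n :: real)\<bar>"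
    by (simp add: abs_mult)
  moreover have "1 / (2 * 3 ^ N) \<le> (1/3) ^ m * (1/2::real)"
    using power_decreasing[OF \<open>m \<le> N\<close>, of "1/3::real"] by (simp add: power_one_over field_simps)
  ultimately show ?thesis
    by linarith
qed

section \<open>Coding a compact metric space by real numbers\<close>

lemma compact_real_code:
  fixes K :: "'a::{metric_space, second_countable_topology} set"
  assumes "compact K"
  obtains s :: "'a \<Rightarrow> real"
  where "s \<in> borel_measurable borel" "\<And>x. 0 \<le> s x" "\<And>x. s x \<le> 3/2"
    "\<And>e. e > 0 \<Longrightarrow> \<exists>d>0. \<forall>x\<in>K. \<forall>y\<in>K. \<bar>s x - s y\<bar> < d \<longrightarrow> dist x y < e"
proof -
  obtain \<B> :: "'a set set" where \<B>: "countable \<B>" "topological_basis \<B>"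
    using ex_countable_basis by blast
  have "\<B> \<noteq> {}"
    using topological_basisE[OF \<B>(2) open_UNIV UNIV_I] by blast
  \<comment> \<open>The enumeration may repeat basis sets; this is harmless, since the gap estimate
    holds for arbitrary digit sequences.\<close>
  define A where "A = from_nat_into \<B>"
  have A: "open (A n)" for n
    unfolding A_def by (rule topological_basis_open[OF \<B>(2) from_nat_into[OF \<open>\<B> \<noteq> {}\<close>]])
  have [measurable]: "A n \<in> sets borel" for n
    using A by simp
  define s where "s x = (\<Sum>n. of_bool (x \<in> A n) * (1/3) ^ n :: real)" for x
  have s_eq: "s = (\<lambda>x. \<Sum>n. indicator (A n) x * (1/3) ^ n)"
    by (auto simp: s_def fun_eq_iff indicator_def of_bool_def)
  show ?thesis
  proof
    show "s \<in> borel_measurable borel"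
      unfolding s_eq by measurable
    show "0 \<le> s x" "s x \<le> 3/2" for x
      unfolding s_def by (rule ternary_bounds)+
    fix e :: real assume "e > 0"
    define I where "I = {n. \<forall>x\<in>A n. \<forall>y\<in>A n. dist x y < e}"
    have "x \<in> (\<Union>n\<in>I. A n)" for x
    proof -
      obtain U where U: "U \<in> \<B>" "x \<in> U" "U \<subseteq> ball x (e/2)"
        using topological_basisE[OF \<B>(2) open_ball, of x x "e/2"] \<open>e > 0\<close> by auto
      obtain n where n: "A n = U"
        unfolding A_def using from_nat_into_surj[OF \<B>(1) U(1)] by blast
      have "dist y z < e" if "y \<in> U" "z \<in> U" for y z
        using that U(3) by (intro dist_triangle_half_r[of x y e z]) auto
      then show ?thesis
        using n U(2) by (auto simp: I_def)
    qed
    then have cover: "K \<subseteq> (\<Union>n\<in>I. A n)"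
      by blast
    obtain J where J: "J \<subseteq> I" "finite J" "K \<subseteq> (\<Union>n\<in>J. A n)"
      by (rule compactE_image[OF \<open>compact K\<close> A cover])
    \<comment> \<open>The largest index of the finite cover fixes the threshold 1 / (2 * 3^N);
      inserting 0 keeps \<open>Max\<close> meaningful when \<open>J\<close> is empty.\<close>
    define N where "N = Max (insert 0 J)"
    have "dist x y < e" if "x \<in> K" "y \<in> K" and close: "\<bar>s x - s y\<bar> < 1 / (2 * 3 ^ N)" for x y
    proof -
      obtain n where n: "n \<in> J" "x \<in> A n"
        using J(3) \<open>x \<in> K\<close> by blast
      have "n \<le> N"
        using J(2) n(1) by (simp add: N_def)
      then have "1 / (2 * 3 ^ N) \<le> 1 / (2 * 3 ^ n :: real)"
        by (simp add: field_simps)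
      \<comment> \<open>If \<open>y\<close> were outside \<open>A n\<close>, the digits at
        \<open>n\<close> would differ and the codes would be at least this far apart.\<close>
      then have "\<not> 1 / (2 * 3 ^ n) \<le> \<bar>s x - s y\<bar>"
        using close by linarith
      then have "y \<in> A n"
        using ternary_gap[of "\<lambda>n. x \<in> A n" n "\<lambda>n. y \<in> A n"] n(2) unfolding s_def by blast
      then show ?thesis
        using n J(1) by (auto simp: I_def)
    qed
    then show "\<exists>d>0. \<forall>x\<in>K. \<forall>y\<in>K. \<bar>s x - s y\<bar> < d \<longrightarrow> dist x y < e"
      by (intro exI[of _ "1 / (2 * 3 ^ N)"]) auto
  qed
qed

text \<open>The image \<open>s\<close> K\<open>need not be closed, yet limits of codes have to be
  decoded. A uniformly continuous map into a complete space extends to the closure,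
  so\<close>C\<open>is the closure of\<close>s \<open>K\<close> and \<open>g\<close> the extended
  inverse.\<close>

lemma compact_real_parametrization:
  fixes K :: "'a::polish_space set"
  assumes "compact K"
  obtains s :: "'a \<Rightarrow> real" and C :: "real set" and g :: "real \<Rightarrow> 'a"
  where "s \<in> borel_measurable borel" "\<And>x. 0 \<le> s x" "\<And>x. s x \<le> 3/2"
    "closed C" "continuous_on C g" "g ` C \<subseteq> K" "\<And>x. x \<in> K \<Longrightarrow> s x \<in> C" "\<And>x. x \<in> K \<Longrightarrow> g (s x) = x"
proof -
  obtain s :: "'a \<Rightarrow> real" where s: "s \<in> borel_measurable borel" "\<And>x. 0 \<le> s x" "\<And>x. s x \<le> 3/2"
    and unif: "\<And>e. e > 0 \<Longrightarrow> \<exists>d>0. \<forall>x\<in>K. \<forall>y\<in>K. \<bar>s x - s y\<bar> < d \<longrightarrow> dist x y < e"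
    using compact_real_code[OF assms] by metis
  have "inj_on s K"
  proof (rule inj_onI, rule ccontr)
    fix x y assume "x \<in> K" "y \<in> K" "s x = s y" "x \<noteq> y"
    moreover obtain d where "d > 0" "\<forall>a\<in>K. \<forall>b\<in>K. \<bar>s a - s b\<bar> < d \<longrightarrow> dist a b < dist x y"
      using unif[of "dist x y"] \<open>x \<noteq> y\<close> by auto
    ultimately have "dist x y < dist x y"
      by (metis abs_zero diff_self)
    then show False
      by simp
  qed
  have "uniformly_continuous_on (s ` K) (the_inv_into K s)"
    unfolding uniformly_continuous_on_def
  proof (intro allI impI)
    fix e :: real assume "e > 0"
    then obtain d where "d > 0" "\<forall>x\<in>K. \<forall>y\<in>K. \<bar>s x - s y\<bar> < d \<longrightarrow> dist x y < e"
      using unif by blast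
    then show "\<exists>d>0. \<forall>x\<in>s ` K. \<forall>x'\<in>s ` K. dist x' x < d \<longrightarrow>
        dist (the_inv_into K s x') (the_inv_into K s x) < e"
      by (intro exI[of _ d]) (auto simp: the_inv_into_f_f[OF \<open>inj_on s K\<close>] dist_real_def)
  qed
  then obtain g where g: "uniformly_continuous_on (closure (s ` K)) g"
    "\<And>x. x \<in> s ` K \<Longrightarrow> the_inv_into K s x = g x"
    using uniformly_continuous_on_extension_on_closure by metis
  have cont: "continuous_on (closure (s ` K)) g"
    using g(1) by (rule uniformly_continuous_imp_continuous)
  have inv: "g (s x) = x" if "x \<in> K" for x
    using g(2)[of "s x"] that by (simp add: the_inv_into_f_f[OF \<open>inj_on s K\<close>])
  \<comment> \<open>By continuity the new values are limits of points of \<open>K\<close>, hence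
    stay in the closed set \<open>K\<close>.\<close>
  have "g ` closure (s ` K) \<subseteq> K"
    using inv by (intro image_closure_subset[OF cont]) (auto simp: compact_imp_closed[OF assms])
  then show ?thesis
    using closure_subset[of "s ` K"] by (intro that[OF s closed_closure cont _ _ inv]) auto
qed

section \<open>Precompactness of the probability measures on a compact set\<close>

lemma prob_measures_on_AE:
  assumes "\<rho> \<in> prob_measures_on K" "closed K"
  shows "AE x in \<rho>. x \<in> K"
proof -
  interpret prob_space \<rho>
    using assms by (simp add: prob_measures_on_def)
  have "K \<in> sets \<rho>"
    using assms by (simp add: prob_measures_on_def)
  moreover have "prob K = 1"
    using assms by (simp add: prob_measures_on_def measure_def)
  ultimately show ?thesis
    using prob_eq_1 by blast
qed

theorem W1_precompact_prob_measures_on: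
  fixes K :: "'a::polish_space set"
  assumes "compact K"
  shows "W1_precompact K (prob_measures_on K)"
  unfolding W1_precompact_def
proof (intro allI impI)
  fix \<mu> :: "nat \<Rightarrow> 'a measure"
  assume \<mu>: "\<forall>n. \<mu> n \<in> prob_measures_on K"
  have sets_\<mu>[simp, measurable_cong]: "sets (\<mu> n) = sets borel" for n
    using \<mu> by (auto simp: prob_measures_on_def)
  interpret \<mu>: prob_space "\<mu> n" for n
    using \<mu> by (auto simp: prob_measures_on_def)
  have "closed K"
    using assms by (rule compact_imp_closed)
  have \<mu>_K: "AE x in \<mu> n. x \<in> K" for n
    using prob_measures_on_AE \<mu> \<open>closed K\<close> by blast
  have "K \<noteq> {}"
    using \<mu> by (auto simp: prob_measures_on_def)
  then obtain x0 where "x0 \<in> K"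
    by blast
  obtain s :: "'a \<Rightarrow> real" and C g where
    s[measurable]: "s \<in> borel_measurable borel" and s_bounds: "\<And>x. 0 \<le> s x" "\<And>x. s x \<le> 3/2"
    and C: "closed C" "continuous_on C g" "g ` C \<subseteq> K"
    and sC: "\<And>x. x \<in> K \<Longrightarrow> s x \<in> C" and gs: "\<And>x. x \<in> K \<Longrightarrow> g (s x) = x"
    using compact_real_parametrization[OF assms] by metis
  \<comment> \<open>The default value \<open>x0\<close> makes \<open>G\<close> total with all values
    in \<open>K\<close>. Thus the law of any \<open>G\<close>-image is carried by \<open>K\<close>,
    and distances between such images are at most \<open>diameter K\<close>.\<close>
  define G where "G z = (if z \<in> C then g z else x0)" for z
  have [measurable]: "G \<in> borel_measurable borel"
    unfolding G_def using C by (intro borel_measurable_continuous_on_if) auto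
  have [measurable]: "C \<in> sets borel"
    using C(1) by simp
  have G_K: "G z \<in> K" for z
    using C(3) \<open>x0 \<in> K\<close> by (auto simp: G_def)

  have "tight (\<lambda>n. distr (\<mu> n) borel s)"
    unfolding tight_def
  proof (intro conjI allI impI)
    show "real_distribution (distr (\<mu> n) borel s)" for n
      by (intro \<mu>.real_distribution_distr) measurable
    fix \<epsilon> :: real assume "\<epsilon> > 0"
    \<comment> \<open>Tightness is phrased with half-open intervals; this one contains the whole
      range [0, 3/2] of \<open>s\<close>, so no mass escapes.\<close>
    have "s -` {-1<..2} = UNIV"
      using s_bounds by (auto simp: less_le_trans[OF _ s_bounds(1)] order_trans[OF s_bounds(2)])
    then have "measure (distr (\<mu> n) borel s) {-1<..2} = 1" for n
      using \<mu>.prob_space[of n] by (subst measure_distr) auto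
    with \<open>\<epsilon> > 0\<close> show "\<exists>a b. a < b \<and> (\<forall>n. 1 - \<epsilon> < measure (distr (\<mu> n) borel s) {a<..b})"
      by (intro exI[of _ "-1"] exI[of _ 2]) auto
  qed
  from tight_imp_convergent_subsubsequence[OF this strict_mono_id]
  obtain r M where r: "strict_mono (r :: nat \<Rightarrow> nat)" "real_distribution M"
    "weak_conv_m (\<lambda>n. distr (\<mu> (r n)) borel s) M"
    by (auto simp: o_def)
  have "real_distribution (distr (\<mu> (r n)) borel s)" for n
    by (intro \<mu>.real_distribution_distr) measurable
  from Skorohod[OF this r(2,3)] obtain \<Omega> :: "real measure" and Z Y where \<Omega>: "prob_space \<Omega>"
    and Z[measurable]: "\<And>n. Z n \<in> borel_measurable \<Omega>"
    and distr_Z: "\<And>n. distr \<Omega> borel (Z n) = distr (\<mu> (r n)) borel s"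
    and Y[measurable]: "Y \<in> borel_measurable \<Omega>"
    and lim: "\<And>w. w \<in> space \<Omega> \<Longrightarrow> (\<lambda>n. Z n w) \<longlonglongrightarrow> Y w"
    by force
  interpret \<Omega>: prob_space \<Omega> by fact

  \<comment> \<open>Decoding undoes coding: \<open>Z n\<close> has the law of \<open>s\<close> under
    \<open>\<mu> (r n)\<close>, and \<open>G\<close> after \<open>s\<close> is the identity on
    \<open>K\<close>, which has full measure.\<close>
  have Z_law: "distr \<Omega> borel (\<lambda>w. G (Z n w)) = \<mu> (r n)" for n
  proof -
    have "distr \<Omega> borel (\<lambda>w. G (Z n w)) = distr (distr \<Omega> borel (Z n)) borel G"
      by (subst distr_distr) (auto simp: o_def)
    also have "\<dots> = distr (\<mu> (r n)) borel (\<lambda>x. G (s x))"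
      unfolding distr_Z by (subst distr_distr) (auto simp: o_def)
    also have "\<dots> = distr (\<mu> (r n)) borel (\<lambda>x. x)"
    proof (rule distr_cong_AE[OF refl refl])
      show "AE x in \<mu> (r n). G (s x) = x"
        using \<mu>_K[of "r n"] by eventually_elim (simp add: G_def sC gs)
    qed measurable
    also have "\<dots> = \<mu> (r n)"
      by (intro distr_id2) simp
    finally show ?thesis .
  qed
  \<comment> \<open>Weak convergence passes through \<open>g\<close> only along points of
    \<open>C\<close>, where \<open>g\<close> is continuous. Membership in \<open>C\<close> depends
    on the law alone, so it carries over from the codes to \<open>Z n\<close>.\<close>
  have "AE w in \<Omega>. Z n w \<in> C" for n
  proof -
    have "AE z in distr (\<mu> (r n)) borel s. z \<in> C"
      using \<mu>_K[of "r n"] by (subst AE_distr_iff) (auto simp: sC)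
    then show ?thesis
      unfolding distr_Z[symmetric] by (subst (asm) AE_distr_iff) auto
  qed
  then have Z_C: "AE w in \<Omega>. \<forall>n. Z n w \<in> C"
    by (simp add: AE_all_countable)
  have G_lim: "AE w in \<Omega>. (\<lambda>n. ennreal (dist (G (Z n w)) (G (Y w)))) \<longlonglongrightarrow> 0"
    using Z_C AE_space
  proof eventually_elim
    case (elim w)
    then have "Y w \<in> C"
      using closed_sequentially[OF C(1), of "\<lambda>n. Z n w"] lim by simp
    then have "(\<lambda>n. g (Z n w)) \<longlonglongrightarrow> g (Y w)"
      using elim lim by (intro continuous_on_tendsto_compose[OF C(2)]) auto
    then have "(\<lambda>n. dist (G (Z n w)) (G (Y w))) \<longlonglongrightarrow> 0"
      using elim \<open>Y w \<in> C\<close> unfolding tendsto_dist_iff[of _ "g (Y w)"] by (simp add: G_def)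
    from tendsto_ennrealI[OF this] show ?case
      by simp
  qed
  have "(\<lambda>n. \<integral>\<^sup>+w. ennreal (dist (G (Z n w)) (G (Y w))) \<partial>\<Omega>) \<longlonglongrightarrow> (\<integral>\<^sup>+w. 0 \<partial>\<Omega>)"
  proof (rule nn_integral_dominated_convergence)
    show "AE w in \<Omega>. ennreal (dist (G (Z n w)) (G (Y w))) \<le> ennreal (diameter K)" for n
      using G_K by (intro AE_I2 ennreal_leI diameter_bounded_bound compact_imp_bounded[OF assms])
    show "(\<integral>\<^sup>+w. ennreal (diameter K) \<partial>\<Omega>) < \<infinity>"
      by (simp add: \<Omega>.emeasure_space_1)
  qed (use G_lim in auto)
  then have cost: "(\<lambda>n. \<integral>\<^sup>+w. ennreal (dist (G (Z n w)) (G (Y w))) \<partial>\<Omega>) \<longlonglongrightarrow> 0"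
    by simp

  define \<nu> where "\<nu> = distr \<Omega> borel (\<lambda>w. G (Y w))"
  have "\<nu> \<in> prob_measures_on K"
  proof -
    have "prob_space \<nu>"
      unfolding \<nu>_def by (intro \<Omega>.prob_space_distr) measurable
    moreover have "emeasure \<nu> K = 1"
      unfolding \<nu>_def using G_K \<open>closed K\<close>
      by (subst emeasure_distr) (auto simp: vimage_def \<Omega>.emeasure_space_1)
    ultimately show ?thesis
      by (simp add: prob_measures_on_def \<nu>_def)
  qed
  have W1_le: "W1 (\<mu> (r n)) \<nu> \<le> (\<integral>\<^sup>+w. ennreal (dist (G (Z n w)) (G (Y w))) \<partial>\<Omega>)" for n
  proof -
    \<comment> \<open>The joint law of the decoded variables is an admissible transport plan, so its
      cost bounds the infimum defining \<open>W1\<close>.\<close>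
    define \<pi> where "\<pi> = distr \<Omega> borel (\<lambda>w. (G (Z n w), G (Y w)))"
    have pair[measurable]: "(\<lambda>w. (G (Z n w), G (Y w))) \<in> borel_measurable \<Omega>"
      by (intro borel_measurable_Pair) measurable
    have proj[measurable]: "fst \<in> borel_measurable (borel :: ('a \<times> 'a) measure)"
      "snd \<in> borel_measurable (borel :: ('a \<times> 'a) measure)"
      by (intro borel_measurable_continuous_onI continuous_intros)+
    have "\<pi> \<in> couplings (\<mu> (r n)) \<nu>"
      unfolding couplings_def \<pi>_def \<nu>_def Z_law[symmetric]
      by (auto simp: distr_distr[OF proj(1) pair] distr_distr[OF proj(2) pair] o_def)
    then have "W1 (\<mu> (r n)) \<nu> \<le> (\<integral>\<^sup>+z. ennreal (dist (fst z) (snd z)) \<partial>\<pi>)"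
      unfolding W1_def by (rule INF_lower)
    also have "\<dots> = (\<integral>\<^sup>+w. ennreal (dist (G (Z n w)) (G (Y w))) \<partial>\<Omega>)"
      unfolding \<pi>_def by (subst nn_integral_distr) auto
    finally show ?thesis .
  qed
  have "(\<lambda>n. W1 (\<mu> (r n)) \<nu>) \<longlonglongrightarrow> 0"
    using W1_le by (intro tendsto_sandwich[OF _ _ tendsto_const cost]) auto
  with r(1) \<open>\<nu> \<in> prob_measures_on K\<close>
  show "\<exists>r \<nu>. strict_mono (r :: nat \<Rightarrow> nat) \<and> \<nu> \<in> prob_measures_on K \<and>
      (\<lambda>n. W1 (\<mu> (r n)) \<nu>) \<longlonglongrightarrow> 0"
    by blast
qed

section \<open>Passage to the trajectory\<close>

lemma W1_precompact_subset: "W1_precompact K T \<Longrightarrow> S \<subseteq> T \<Longrightarrow> W1_precompact K S"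
  unfolding W1_precompact_def by (meson subsetD)

text \<open>A weak solution takes its values in \<open>prob_measures_on K\<close>, with
  \<open>K\<close> compact by the smoothness assumption, and precompactness passes to subsets
  because the limits are only required to lie in \<open>prob_measures_on K\<close>.\<close>

theorem proposition6p9:
  fixes Wout :: "real^'dv::finite^'dx::finite"
    and P :: "('l::{finite,linorder}, 'dx) input measure"
    and Y :: "'l \<Rightarrow> ('l, 'dx) input \<Rightarrow> real^'dv"
    and \<zeta> :: "real \<Rightarrow> real"
    and K :: "('dx, 'dk::finite) head set"
    and Kx :: "(real^'dx) set"
    and \<rho> :: "real \<Rightarrow> ('dx, 'dk) head measure"
  assumes "prob_space P" and "sets P = sets borel"
    and "\<And>l. Y l \<in> borel_measurable borel"
    and "\<And>l X. X \<in> inputs_in Kx \<Longrightarrow> one_hot (Y l X)"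
    and "admissible_rate \<zeta>"
    and "smoothness_assumption Wout P K Kx"
    and "weak_solution Wout P Y \<zeta> K \<rho>"
    and "\<And>t. t \<ge> 0 \<Longrightarrow> measure_supp (\<rho> t) \<subseteq> K"
  shows "W1_precompact K {\<rho> t | t. t \<ge> 0}"
proof (rule W1_precompact_subset[OF W1_precompact_prob_measures_on])
  show "compact K"
    using assms(6) by (simp add: smoothness_assumption_def)
  show "{\<rho> t | t. t \<ge> 0} \<subseteq> prob_measures_on K"
    using assms(7) by (auto simp: weak_solution_def)
qed

end
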